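(* Let $d\in\mathbb{N}$, let $\Xi\subset\mathbb{R}^d$ be finite and symmetric, and let $\alpha\in\mathbb{N}^d$. Let $\phi$ be a finite feasible shift rule for $\Xi,\alpha$, and let $f$ be dual feasible, i.e., $f\in\mathscr{K}_\Xi$ with $\|f\|_\infty\le1$. Then the following are equivalent: (i) Both $\phi$ and $f$ are optimal, i.e., $\phi$ minimizes $\|\cdot\|_1$ among all finite feasible shift rules for $\Xi,\alpha$, and $f$ maximizes $g\mapsto(-\partial)^\alpha g(0)$ among all $g\in\mathscr{K}_\Xi$ with $\|g\|_\infty\le1$. (ii) $\operatorname{Supp}\phi\subseteq\{a\in\mathbb{R}^d\mid |f(a)|=1\}$ in such a way that for all $a\in\mathbb{R}^d$ the following implications hold: $\phi(a)<0\Rightarrow f(a)=-1$, and $\phi(a)>0\Rightarrow f(a)=+1$.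
   Context: $\mathbb{N}=\{1,2,3,\dots\}$. A set $\Xi\subset\mathbb{R}^d$ is symmetric if $\Xi=-\Xi$. $\mathscr{K}_\Xi$ denotes the real vector space of functions $f\colon\mathbb{R}^d\to\mathbb{R}$ of the form $f(x)=\sum_{\xi\in\Xi}b_\xi e^{2\pi i\,\xi\bullet x}$ with $b\in\mathbb{C}^\Xi$, $b_{-\xi}=\overline{b_\xi}$, where $\xi\bullet x=\sum_j\xi_jx_j$. $\|f\|_\infty=\sup_x|f(x)|$. $\partial^\alpha=\prod_j\partial_j^{\alpha_j}$ and $(-\partial)^\alpha=(-1)^{|\alpha|}\partial^\alpha$ with $|\alpha|=\sum_j\alpha_j$. A (finite) shift rule is a real signed measure of finite support $\phi=\sum_{a\in A}u_a\delta_a$, with $A\subset\mathbb{R}^d$ finite and $u\in\mathbb{R}^A$; it acts by $(\phi*f)(x)=\sum_{a\in A}u_af(x-a)$. Here $\phi(a):=\phi(\{a\})$ is the mass at the point $a$ (equal to $u_a$ if $a\in A$ and $0$ otherwise). Its cost is $\|\phi\|_1=\sum_{a\in A}|u_a|$. It is feasible for $\Xi,\alpha$ if $\phi*g=\partial^\alpha g$ for all $g\in\mathscr{K}_\Xi$. *)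

theory Defs
  imports "HOL-Analysis.Analysis"
begin

definition symmetric_set :: "(real ^ 'n) set \<Rightarrow> bool" where
  "symmetric_set \<Xi> \<longleftrightarrow> \<Xi> = uminus ` \<Xi>"

definition trig_space :: "(real ^ 'n) set \<Rightarrow> (real ^ 'n \<Rightarrow> real) set" where
  "trig_space \<Xi> = {f. \<exists>b :: real ^ 'n \<Rightarrow> complex.
     (\<forall>\<xi>\<in>\<Xi>. b (- \<xi>) = cnj (b \<xi>)) \<and>
     (\<forall>x. complex_of_real (f x) =
       (\<Sum>\<xi>\<in>\<Xi>. b \<xi> * exp (2 * complex_of_real pi * \<i> * complex_of_real (\<xi> \<bullet> x))))}"

text \<open>The real supremum below is meaningful only for bounded functions; every member of
  \<open>trig_space \<Xi>\<close> with finite \<open>\<Xi>\<close> is bounded.\<close>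

definition sup_norm :: "('a \<Rightarrow> real) \<Rightarrow> real" where
  "sup_norm f = (SUP x. \<bar>f x\<bar>)"

definition partial_deriv :: "'n \<Rightarrow> (real ^ 'n \<Rightarrow> real) \<Rightarrow> real ^ 'n \<Rightarrow> real" where
  "partial_deriv j f x = deriv (\<lambda>t. f (x + t *\<^sub>R axis j 1)) 0"

text \<open>The product of the powers of the partial derivatives is a composition of operators, which
  has to be taken in some order. An arbitrary enumeration of the coordinates is fixed; partial
  derivatives of smooth functions, in particular of members of \<open>trig_space \<Xi>\<close>, commute, so its
  choice does not matter where \<open>multi_deriv\<close> is used.\<close>

definition coord_enum :: "'n::finite list" where
  "coord_enum = (SOME js. distinct js \<and> set js = UNIV)"

definition multi_deriv :: "nat ^ 'n \<Rightarrow> (real ^ 'n \<Rightarrow> real) \<Rightarrow> real ^ 'n \<Rightarrow> real" where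
  "multi_deriv \<alpha> f = foldr (\<lambda>j. partial_deriv j ^^ (\<alpha> $ j)) coord_enum f"

definition neg_multi_deriv :: "nat ^ 'n \<Rightarrow> (real ^ 'n \<Rightarrow> real) \<Rightarrow> real ^ 'n \<Rightarrow> real" where
  "neg_multi_deriv \<alpha> f x = (- 1) ^ (\<Sum>j\<in>UNIV. \<alpha> $ j) * multi_deriv \<alpha> f x"

text \<open>A finitely supported real signed measure is represented by its function of point masses
  \<open>\<phi> a = \<phi> {a}\<close>, which determines it.\<close>

definition supp :: "('a \<Rightarrow> real) \<Rightarrow> 'a set" where
  "supp \<phi> = {a. \<phi> a \<noteq> 0}"

definition shift_rule :: "(real ^ 'n \<Rightarrow> real) \<Rightarrow> bool" where
  "shift_rule \<phi> \<longleftrightarrow> finite (supp \<phi>)"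

definition shift_apply :: "(real ^ 'n \<Rightarrow> real) \<Rightarrow> (real ^ 'n \<Rightarrow> real) \<Rightarrow> real ^ 'n \<Rightarrow> real" where
  "shift_apply \<phi> f x = (\<Sum>a\<in>supp \<phi>. \<phi> a * f (x - a))"

definition cost :: "(real ^ 'n \<Rightarrow> real) \<Rightarrow> real" where
  "cost \<phi> = (\<Sum>a\<in>supp \<phi>. \<bar>\<phi> a\<bar>)"

definition feasible :: "(real ^ 'n) set \<Rightarrow> nat ^ 'n \<Rightarrow> (real ^ 'n \<Rightarrow> real) \<Rightarrow> bool" where
  "feasible \<Xi> \<alpha> \<phi> \<longleftrightarrow>
     shift_rule \<phi> \<and> (\<forall>g\<in>trig_space \<Xi>. shift_apply \<phi> g = multi_deriv \<alpha> g)"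

definition dual_feasible :: "(real ^ 'n) set \<Rightarrow> (real ^ 'n \<Rightarrow> real) \<Rightarrow> bool" where
  "dual_feasible \<Xi> f \<longleftrightarrow> f \<in> trig_space \<Xi> \<and> sup_norm f \<le> 1"

end

theory Submission
  imports Defs
begin

text \<open>Testing the feasibility identity at \<open>0\<close> on reflected functions gives
  \<open>(-\<partial>)\<^sup>\<alpha> g(0) = \<Sum>\<^sub>a \<phi>(a) g(a)\<close>, hence weak duality, and (ii) says that \<open>f\<close> turns it into an equality.
  For the converse, optimality of \<open>\<phi>\<close> means that the convex function
  \<open>\<eta> \<mapsto> \<parallel>\<phi> + \<eta>\<parallel>\<^sub>1 - \<parallel>\<phi>\<parallel>\<^sub>1\<close> is nonnegative on the common kernel of the finitely many functionals
  \<open>\<eta> \<mapsto> \<Sum>\<^sub>a \<eta>(a) g(a)\<close>, \<open>g\<close> a generator of the function space. Lagrange multipliers for these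
  functionals are the coefficients of a dual feasible function attaining \<open>\<parallel>\<phi>\<parallel>\<^sub>1\<close>. No compactness
  is needed, since only the attainment of the primal minimum enters.\<close>

subsection \<open>Lagrange multipliers\<close>

text \<open>A one-dimensional separation argument: a convex combination of points with
  \<open>r x > 0\<close> and \<open>r y < 0\<close> that lands in the kernel of \<open>r\<close>
  yields \<open>q y / r y \<le> q x / r x\<close>. Any number between the two families of quotients
  is a multiplier.\<close>

lemma lagrange_multiplier:
  fixes q r :: "('a \<Rightarrow> real) \<Rightarrow> real"
  assumes subspace: "\<And>x y u v. x \<in> X \<Longrightarrow> y \<in> X \<Longrightarrow> (\<lambda>a. u * x a + v * y a) \<in> X"
    and linear: "\<And>x y u v. x \<in> X \<Longrightarrow> y \<in> X \<Longrightarrow> r (\<lambda>a. u * x a + v * y a) = u * r x + v * r y"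
    and convex: "\<And>x y u v. x \<in> X \<Longrightarrow> y \<in> X \<Longrightarrow> 0 \<le> u \<Longrightarrow> 0 \<le> v \<Longrightarrow> u + v = 1 \<Longrightarrow>
      q (\<lambda>a. u * x a + v * y a) \<le> u * q x + v * q y"
    and nonneg: "\<And>x. x \<in> X \<Longrightarrow> r x = 0 \<Longrightarrow> 0 \<le> q x"
  shows "\<exists>t. \<forall>x\<in>X. t * r x \<le> q x"
proof (cases "\<exists>z\<in>X. r z \<noteq> 0")
  case False
  then show ?thesis using nonneg by (intro exI[of _ 0]) auto
next
  case True
  then obtain z where z: "z \<in> X" "r z \<noteq> 0" by blast
  have neg_z: "(\<lambda>a. (-1) * z a + 0 * z a) \<in> X" "r (\<lambda>a. (-1) * z a + 0 * z a) = - r z"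
    using subspace[OF z(1) z(1), of "-1" 0] linear[OF z(1) z(1), of "-1" 0] by auto
  \<comment> \<open>Points on both sides of the kernel make \<open>L\<close> nonempty and bounded
    above.\<close>
  obtain x0 y0 where x0: "x0 \<in> X" "r x0 > 0" and y0: "y0 \<in> X" "r y0 < 0"
    using z neg_z by (cases "r z > 0") force+
  define L where "L = (\<lambda>y. q y / r y) ` {y \<in> X. r y < 0}"
  have le: "q y / r y \<le> q x / r x" if "x \<in> X" "r x > 0" "y \<in> X" "r y < 0" for x y
  proof -
    define d where "d = r x - r y"
    have d: "d > 0" using that by (simp add: d_def)
    \<comment> \<open>These weights sum to 1 and cancel the values of \<open>r\<close>:
      \<open>u * r x + v * r y = 0\<close>.\<close>
    define u v where "u = - r y / d" and "v = r x / d"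
    have uv: "0 \<le> u" "0 \<le> v"
      using that d by (simp_all add: u_def v_def divide_nonpos_pos)
    have "u + v = d / d"
      unfolding u_def v_def add_divide_distrib[symmetric] by (simp add: d_def)
    then have sum_uv: "u + v = 1" using d by simp
    have "r (\<lambda>a. u * x a + v * y a) = 0"
      unfolding linear[OF that(1,3)] by (simp add: u_def v_def)
    then have "0 \<le> q (\<lambda>a. u * x a + v * y a)"
      using nonneg subspace that(1,3) by blast
    also have "\<dots> \<le> u * q x + v * q y"
      using convex that(1,3) uv sum_uv by blast
    also have "\<dots> = (r x * q y - r y * q x) / d"
      by (simp add: u_def v_def diff_divide_distrib)
    finally have "r y * q x \<le> r x * q y"
      using d by (simp add: zero_le_divide_iff)
    then show ?thesis using that by (simp add: field_simps)
  qed
  have upper: "Sup L \<le> q x / r x" if "x \<in> X" "r x > 0" for x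
    using le[OF that] y0 unfolding L_def by (intro cSup_least) auto
  have lower: "q y / r y \<le> Sup L" if "y \<in> X" "r y < 0" for y
  proof (rule cSup_upper)
    show "q y / r y \<in> L" using that by (auto simp: L_def)
    show "bdd_above L"
      using le[OF x0] by (auto simp: L_def intro!: bdd_aboveI[of _ "q x0 / r x0"])
  qed
  have "Sup L * r x \<le> q x" if "x \<in> X" for x
  proof -
    consider "r x > 0" | "r x = 0" | "r x < 0" by linarith
    then show ?thesis
    proof cases
      case 1
      then show ?thesis using upper[OF that] by (simp add: field_simps)
    next
      case 2
      then show ?thesis using nonneg[OF that] by simp
    next
      case 3
      then show ?thesis using lower[OF that] by (simp add: field_simps)
    qed
  qed
  then show ?thesis by blast
qed

text \<open>Induction on \<open>K\<close>. On the common kernel \<open>Y\<close> of the remaining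
  functionals, the single-multiplier lemma provides \<open>s\<close> for \<open>r i\<close>. Then
  \<open>q - s * r i\<close> is nonnegative on \<open>Y\<close>, and still convex because
  \<open>r i\<close> is linear. As the objective changes, the induction keeps \<open>q\<close>
  arbitrary.\<close>

lemma lagrange_multipliers:
  fixes q :: "('a \<Rightarrow> real) \<Rightarrow> real" and r :: "'k \<Rightarrow> ('a \<Rightarrow> real) \<Rightarrow> real"
  assumes "finite K"
    and subspace: "\<And>x y u v. x \<in> X \<Longrightarrow> y \<in> X \<Longrightarrow> (\<lambda>a. u * x a + v * y a) \<in> X"
    and linear: "\<And>k x y u v. x \<in> X \<Longrightarrow> y \<in> X \<Longrightarrow>
      r k (\<lambda>a. u * x a + v * y a) = u * r k x + v * r k y"
    and convex: "\<And>x y u v. x \<in> X \<Longrightarrow> y \<in> X \<Longrightarrow> 0 \<le> u \<Longrightarrow> 0 \<le> v \<Longrightarrow> u + v = 1 \<Longrightarrow>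
      q (\<lambda>a. u * x a + v * y a) \<le> u * q x + v * q y"
    and nonneg: "\<And>x. x \<in> X \<Longrightarrow> \<forall>k\<in>K. r k x = 0 \<Longrightarrow> 0 \<le> q x"
  shows "\<exists>t. \<forall>x\<in>X. (\<Sum>k\<in>K. t k * r k x) \<le> q x"
  using assms(1) convex nonneg
proof (induction K arbitrary: q)
  case empty
  then show ?case by auto
next
  case (insert i K)
  define Y where "Y = {x \<in> X. \<forall>k\<in>K. r k x = 0}"
  have "\<exists>s. \<forall>x\<in>Y. s * r i x \<le> q x"
  proof (rule lagrange_multiplier)
    show "(\<lambda>a. u * x a + v * y a) \<in> Y" if "x \<in> Y" "y \<in> Y" for x y u v
      using that subspace linear by (auto simp: Y_def)
  qed (use linear insert.prems in \<open>auto simp: Y_def\<close>)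
  then obtain s where s: "\<And>x. x \<in> Y \<Longrightarrow> s * r i x \<le> q x" by blast
  have "\<exists>t. \<forall>x\<in>X. (\<Sum>k\<in>K. t k * r k x) \<le> q x - s * r i x"
  proof (rule insert.IH)
    show "q (\<lambda>a. u * x a + v * y a) - s * r i (\<lambda>a. u * x a + v * y a)
        \<le> u * (q x - s * r i x) + v * (q y - s * r i y)"
      if "x \<in> X" "y \<in> X" "0 \<le> u" "0 \<le> v" "u + v = 1" for x y u v
      using insert.prems(1)[OF that] linear[OF that(1,2)] by (simp add: algebra_simps)
    show "0 \<le> q x - s * r i x" if "x \<in> X" "\<forall>k\<in>K. r k x = 0" for x
      using s[of x] that by (simp add: Y_def)
  qed
  then obtain t where t: "\<And>x. x \<in> X \<Longrightarrow> (\<Sum>k\<in>K. t k * r k x) \<le> q x - s * r i x" by blast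
  have "(\<Sum>k\<in>insert i K. (t(i := s)) k * r k x) \<le> q x" if "x \<in> X" for x
  proof -
    have "(\<Sum>k\<in>K. (t(i := s)) k * r k x) = (\<Sum>k\<in>K. t k * r k x)"
      using insert.hyps by (intro sum.cong) auto
    then show ?thesis using t[OF that] insert.hyps by simp
  qed
  then show ?case by blast
qed

subsection \<open>The trigonometric space in real form\<close>

text \<open>No relation between the real coefficients at \<open>\<xi>\<close> and
  \<open>- \<xi>\<close> is imposed, so they can serve as free multipliers; the conjugation
  condition is produced by symmetrizing.\<close>

lemma trig_spaceI:
  assumes "finite \<Xi>" "symmetric_set \<Xi>"
    and f: "\<And>x. f x = (\<Sum>\<xi>\<in>\<Xi>. p \<xi> * cos (2 * pi * (\<xi> \<bullet> x)) + q \<xi> * sin (2 * pi * (\<xi> \<bullet> x)))"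
  shows "f \<in> trig_space \<Xi>"
proof -
  \<comment> \<open>Twice the real part of \<open>c \<xi> * cis s\<close> is
    \<open>p \<xi> * cos s + q \<xi> * sin s\<close>. The coefficient \<open>b\<close> collects
    \<open>c\<close> and the conjugate terms, the latter moved to frequency
    \<open>- \<xi>\<close>.\<close>
  define c where "c \<xi> = Complex (p \<xi> / 2) (- q \<xi> / 2)" for \<xi>
  define b where "b \<xi> = c \<xi> + cnj (c (- \<xi>))" for \<xi>
  have refl: "(\<Sum>\<xi>\<in>\<Xi>. h (- \<xi>)) = (\<Sum>\<xi>\<in>\<Xi>. h \<xi>)" for h :: "real ^ 'a \<Rightarrow> complex"
    using assms(2) unfolding symmetric_set_def
    by (intro sum.reindex_bij_witness[of _ uminus uminus]) auto
  have "complex_of_real (f x) =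
      (\<Sum>\<xi>\<in>\<Xi>. b \<xi> * exp (2 * complex_of_real pi * \<i> * complex_of_real (\<xi> \<bullet> x)))" for x
  proof -
    have exp: "exp (2 * complex_of_real pi * \<i> * complex_of_real (\<xi> \<bullet> x)) = cis (2 * pi * (\<xi> \<bullet> x))" for \<xi>
      by (simp add: cis_conv_exp mult_ac)
    have "(\<Sum>\<xi>\<in>\<Xi>. b \<xi> * cis (2 * pi * (\<xi> \<bullet> x))) =
        (\<Sum>\<xi>\<in>\<Xi>. c \<xi> * cis (2 * pi * (\<xi> \<bullet> x))) + (\<Sum>\<xi>\<in>\<Xi>. cnj (c (- \<xi>)) * cis (2 * pi * (\<xi> \<bullet> x)))"
      by (simp add: b_def algebra_simps sum.distrib)
    also have "(\<Sum>\<xi>\<in>\<Xi>. cnj (c (- \<xi>)) * cis (2 * pi * (\<xi> \<bullet> x)))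
        = (\<Sum>\<xi>\<in>\<Xi>. cnj (c \<xi>) * cis (- (2 * pi * (\<xi> \<bullet> x))))"
      using refl[of "\<lambda>\<xi>. cnj (c \<xi>) * cis (- (2 * pi * (\<xi> \<bullet> x)))"] by simp
    also have "(\<Sum>\<xi>\<in>\<Xi>. c \<xi> * cis (2 * pi * (\<xi> \<bullet> x))) + \<dots> = complex_of_real (f x)"
      unfolding f of_real_sum sum.distrib[symmetric]
      by (intro sum.cong) (auto simp: c_def complex_eq_iff field_simps)
    finally show ?thesis using exp by simp
  qed
  moreover have "\<forall>\<xi>\<in>\<Xi>. b (- \<xi>) = cnj (b \<xi>)" by (simp add: b_def)
  ultimately show ?thesis unfolding trig_space_def by blast
qed

lemma trig_spaceE:
  assumes "f \<in> trig_space \<Xi>"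
  obtains p q where
    "\<And>x. f x = (\<Sum>\<xi>\<in>\<Xi>. p \<xi> * cos (2 * pi * (\<xi> \<bullet> x)) + q \<xi> * sin (2 * pi * (\<xi> \<bullet> x)))"
proof -
  obtain b where b: "\<And>x. complex_of_real (f x) =
      (\<Sum>\<xi>\<in>\<Xi>. b \<xi> * exp (2 * complex_of_real pi * \<i> * complex_of_real (\<xi> \<bullet> x)))"
    using assms unfolding trig_space_def by blast
  have "f x = (\<Sum>\<xi>\<in>\<Xi>. Re (b \<xi>) * cos (2 * pi * (\<xi> \<bullet> x)) + (- Im (b \<xi>)) * sin (2 * pi * (\<xi> \<bullet> x)))" for x
  proof -
    have exp: "exp (2 * complex_of_real pi * \<i> * complex_of_real (\<xi> \<bullet> x)) = cis (2 * pi * (\<xi> \<bullet> x))" for \<xi>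
      by (simp add: cis_conv_exp mult_ac)
    have "f x = Re (\<Sum>\<xi>\<in>\<Xi>. b \<xi> * cis (2 * pi * (\<xi> \<bullet> x)))"
      using b[of x] unfolding exp by (metis Re_complex_of_real)
    then show ?thesis by simp
  qed
  then show ?thesis by (rule that)
qed

text \<open>The addition formulas give the new coefficients. This invariance lets a convolution at
  any point \<open>x\<close> be read as a pairing with a member of the same space.\<close>

lemma trig_space_reflect:
  assumes "finite \<Xi>" "symmetric_set \<Xi>" "g \<in> trig_space \<Xi>"
  shows "(\<lambda>y. g (x - y)) \<in> trig_space \<Xi>"
proof -
  obtain p q where g:
    "\<And>x. g x = (\<Sum>\<xi>\<in>\<Xi>. p \<xi> * cos (2 * pi * (\<xi> \<bullet> x)) + q \<xi> * sin (2 * pi * (\<xi> \<bullet> x)))"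
    using trig_spaceE[OF assms(3)] by blast
  let ?c = "\<lambda>\<xi>. cos (2 * pi * (\<xi> \<bullet> x))" and ?s = "\<lambda>\<xi>. sin (2 * pi * (\<xi> \<bullet> x))"
  show ?thesis
    by (rule trig_spaceI[OF assms(1,2), where p = "\<lambda>\<xi>. p \<xi> * ?c \<xi> + q \<xi> * ?s \<xi>"
            and q = "\<lambda>\<xi>. p \<xi> * ?s \<xi> - q \<xi> * ?c \<xi>"])
      (auto simp: g inner_diff_right right_diff_distrib cos_diff sin_diff algebra_simps intro!: sum.cong)
qed

lemma trig_space_bounded:
  assumes "f \<in> trig_space \<Xi>"
  shows "bdd_above (range (\<lambda>x. \<bar>f x\<bar>))"
proof -
  obtain p q where f:
    "\<And>x. f x = (\<Sum>\<xi>\<in>\<Xi>. p \<xi> * cos (2 * pi * (\<xi> \<bullet> x)) + q \<xi> * sin (2 * pi * (\<xi> \<bullet> x)))"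
    using trig_spaceE[OF assms] by blast
  have "\<bar>f x\<bar> \<le> (\<Sum>\<xi>\<in>\<Xi>. \<bar>p \<xi>\<bar> + \<bar>q \<xi>\<bar>)" for x
  proof -
    have "\<bar>u * cos s + v * sin s\<bar> \<le> \<bar>u\<bar> + \<bar>v\<bar>" for u v s :: real
    proof -
      have "\<bar>u * cos s + v * sin s\<bar> \<le> \<bar>u\<bar> * \<bar>cos s\<bar> + \<bar>v\<bar> * \<bar>sin s\<bar>"
        by (metis abs_mult abs_triangle_ineq)
      also have "\<dots> \<le> \<bar>u\<bar> * 1 + \<bar>v\<bar> * 1"
        by (intro add_mono mult_left_mono) auto
      finally show ?thesis by simp
    qed
    then show ?thesis unfolding f by (intro order_trans[OF sum_abs] sum_mono)
  qed
  then show ?thesis by (intro bdd_aboveI) auto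
qed

lemma dual_feasible_iff:
  "dual_feasible \<Xi> f \<longleftrightarrow> f \<in> trig_space \<Xi> \<and> (\<forall>x. \<bar>f x\<bar> \<le> 1)"
proof -
  have "sup_norm f \<le> 1 \<longleftrightarrow> (\<forall>x. \<bar>f x\<bar> \<le> 1)" if "f \<in> trig_space \<Xi>"
    unfolding sup_norm_def using cSUP_le_iff[OF _ trig_space_bounded[OF that]] by auto
  then show ?thesis unfolding dual_feasible_def by auto
qed

subsection \<open>Derivatives and reflection\<close>

text \<open>Termwise differentiation exchanges the cosine and sine coefficients up to a factor. An
  actual derivative is recorded because \<open>deriv\<close> is informative only where one
  exists.\<close>

lemma trig_space_partial_derivative:
  assumes "finite \<Xi>" "symmetric_set \<Xi>" "g \<in> trig_space \<Xi>"
  obtains g' where "g' \<in> trig_space \<Xi>"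
    "\<And>x. ((\<lambda>t. g (x + t *\<^sub>R axis j 1)) has_real_derivative g' x) (at 0)"
proof -
  obtain p q where g:
    "\<And>x. g x = (\<Sum>\<xi>\<in>\<Xi>. p \<xi> * cos (2 * pi * (\<xi> \<bullet> x)) + q \<xi> * sin (2 * pi * (\<xi> \<bullet> x)))"
    using trig_spaceE[OF assms(3)] by blast
  define g' where "g' x = (\<Sum>\<xi>\<in>\<Xi>. (2 * pi * \<xi> $ j * q \<xi>) * cos (2 * pi * (\<xi> \<bullet> x)) +
      (- 2 * pi * \<xi> $ j * p \<xi>) * sin (2 * pi * (\<xi> \<bullet> x)))" for x
  show ?thesis
  proof (rule that)
    show "g' \<in> trig_space \<Xi>" using g'_def by (rule trig_spaceI[OF assms(1,2)])
    show "((\<lambda>t. g (x + t *\<^sub>R axis j 1)) has_real_derivative g' x) (at 0)" for x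
      unfolding g g'_def
      by (auto intro!: derivative_eq_intros sum.cong simp: inner_add_right inner_axis algebra_simps)
  qed
qed

lemma partial_deriv_mem_trig_space:
  assumes "finite \<Xi>" "symmetric_set \<Xi>" "g \<in> trig_space \<Xi>"
  shows "partial_deriv j g \<in> trig_space \<Xi>"
proof -
  obtain g' where g': "g' \<in> trig_space \<Xi>"
    "\<And>x. ((\<lambda>t. g (x + t *\<^sub>R axis j 1)) has_real_derivative g' x) (at 0)"
    using trig_space_partial_derivative[OF assms] by blast
  then have "partial_deriv j g = g'"
    by (auto simp: partial_deriv_def fun_eq_iff intro: DERIV_imp_deriv)
  then show ?thesis using g'(1) by simp
qed

text \<open>The chain rule at the reflected point. The scalar \<open>s\<close> absorbs the signs
  accumulated by earlier derivatives, so that the rule can be iterated.\<close>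

lemma partial_deriv_reflect:
  assumes "finite \<Xi>" "symmetric_set \<Xi>" "g \<in> trig_space \<Xi>"
  shows "partial_deriv j (\<lambda>x. s * g (- x)) = (\<lambda>x. (- s) * partial_deriv j g (- x))"
proof
  fix x
  obtain g' where g':
    "\<And>x. ((\<lambda>t. g (x + t *\<^sub>R axis j 1)) has_real_derivative g' x) (at 0)"
    using trig_space_partial_derivative[OF assms] by blast
  \<comment> \<open>The point is written as \<open>- 0\<close> to match
    \<open>DERIV_mirror\<close>.\<close>
  have "((\<lambda>t. g (- x + t *\<^sub>R axis j 1)) has_real_derivative g' (- x)) (at (- 0))"
    using g'[of "- x"] by simp
  from DERIV_cmult[OF iffD1[OF DERIV_mirror this], of s]
  have "((\<lambda>t. s * g (- (x + t *\<^sub>R axis j 1))) has_real_derivative (- s) * g' (- x)) (at 0)"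
    by (simp add: algebra_simps)
  then have "partial_deriv j (\<lambda>x. s * g (- x)) x = (- s) * g' (- x)"
    unfolding partial_deriv_def by (rule DERIV_imp_deriv)
  moreover have "partial_deriv j g (- x) = g' (- x)"
    unfolding partial_deriv_def by (rule DERIV_imp_deriv[OF g'])
  ultimately show "partial_deriv j (\<lambda>x. s * g (- x)) x = (- s) * partial_deriv j g (- x)"
    by simp
qed

text \<open>Membership is carried through the induction since each further reflection step requires
  it of the previous derivative.\<close>

lemma partial_deriv_funpow_reflect:
  assumes "finite \<Xi>" "symmetric_set \<Xi>" "g \<in> trig_space \<Xi>"
  shows "(partial_deriv j ^^ n) g \<in> trig_space \<Xi> \<and>
    (partial_deriv j ^^ n) (\<lambda>x. s * g (- x)) = (\<lambda>x. (-1) ^ n * s * (partial_deriv j ^^ n) g (- x))"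
proof (induction n)
  case (Suc n)
  then show ?case
    using partial_deriv_mem_trig_space[OF assms(1,2)] partial_deriv_reflect[OF assms(1,2)] by simp
qed (use assms in auto)

lemma foldr_partial_deriv_reflect:
  assumes "finite \<Xi>" "symmetric_set \<Xi>" "g \<in> trig_space \<Xi>"
  shows "foldr (\<lambda>j. partial_deriv j ^^ n j) js g \<in> trig_space \<Xi> \<and>
    foldr (\<lambda>j. partial_deriv j ^^ n j) js (\<lambda>x. g (- x)) =
      (\<lambda>x. (-1) ^ sum_list (map n js) * foldr (\<lambda>j. partial_deriv j ^^ n j) js g (- x))"
proof (induction js)
  case (Cons j js)
  then show ?case
    using partial_deriv_funpow_reflect[OF assms(1,2)] by (simp add: power_add)
qed (use assms in auto)

lemma multi_deriv_reflect:
  assumes "finite \<Xi>" "symmetric_set \<Xi>" "g \<in> trig_space \<Xi>"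
  shows "multi_deriv \<alpha> (\<lambda>x. g (- x)) 0 = neg_multi_deriv \<alpha> g 0"
proof -
  \<comment> \<open>Each coordinate occurs exactly once in the chosen enumeration, so the
    accumulated sign has exponent equal to the order of \<open>\<alpha>\<close>.\<close>
  have "distinct (coord_enum :: 'a list) \<and> set (coord_enum :: 'a list) = UNIV"
    unfolding coord_enum_def
    by (rule someI_ex) (use finite_distinct_list[of "UNIV :: 'a set"] in auto)
  then have "sum_list (map (($) \<alpha>) coord_enum) = (\<Sum>j\<in>UNIV. \<alpha> $ j)"
    by (metis sum.distinct_set_conv_list)
  then show ?thesis
    using foldr_partial_deriv_reflect[OF assms, of "($) \<alpha>" coord_enum]
    unfolding multi_deriv_def neg_multi_deriv_def by simp
qed

subsection \<open>Pairing and cost\<close>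

definition pairing :: "('a \<Rightarrow> real) \<Rightarrow> ('a \<Rightarrow> real) \<Rightarrow> real" where
  "pairing \<phi> g = (\<Sum>a\<in>supp \<phi>. \<phi> a * g a)"

lemma shift_apply_eq_pairing: "shift_apply \<phi> g x = pairing \<phi> (\<lambda>a. g (x - a))"
  by (simp add: shift_apply_def pairing_def)

text \<open>Supports vary under linear combinations; sums are compared over a common finite
  superset.\<close>

lemma pairing_eq_sum:
  assumes "finite A" "supp \<phi> \<subseteq> A"
  shows "pairing \<phi> g = (\<Sum>a\<in>A. \<phi> a * g a)"
  unfolding pairing_def using assms by (intro sum.mono_neutral_left) (auto simp: supp_def)

lemma cost_eq_sum:
  assumes "finite A" "supp \<phi> \<subseteq> A"
  shows "cost \<phi> = (\<Sum>a\<in>A. \<bar>\<phi> a\<bar>)"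
  unfolding cost_def using assms by (intro sum.mono_neutral_left) (auto simp: supp_def)

lemma supp_lincomb: "supp (\<lambda>a. u * \<phi> a + v * \<psi> a) \<subseteq> supp \<phi> \<union> supp \<psi>"
  by (auto simp: supp_def)

lemma shift_rule_lincomb:
  assumes "shift_rule \<phi>" "shift_rule \<psi>"
  shows "shift_rule (\<lambda>a. u * \<phi> a + v * \<psi> a)"
  unfolding shift_rule_def by (rule finite_subset[OF supp_lincomb]) (use assms in \<open>simp add: shift_rule_def\<close>)

lemma pairing_lincomb:
  assumes "shift_rule \<phi>" "shift_rule \<psi>"
  shows "pairing (\<lambda>a. u * \<phi> a + v * \<psi> a) g = u * pairing \<phi> g + v * pairing \<psi> g"
proof -
  have fin: "finite (supp \<phi> \<union> supp \<psi>)" using assms by (simp add: shift_rule_def)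
  show ?thesis
    unfolding pairing_eq_sum[OF fin supp_lincomb] pairing_eq_sum[OF fin Un_upper1]
      pairing_eq_sum[OF fin Un_upper2]
    by (simp add: sum.distrib sum_distrib_left distrib_right mult.assoc)
qed

lemma cost_lincomb_le:
  assumes "shift_rule \<phi>" "shift_rule \<psi>" "0 \<le> u" "0 \<le> v"
  shows "cost (\<lambda>a. u * \<phi> a + v * \<psi> a) \<le> u * cost \<phi> + v * cost \<psi>"
proof -
  have fin: "finite (supp \<phi> \<union> supp \<psi>)" using assms by (simp add: shift_rule_def)
  show ?thesis
    unfolding cost_eq_sum[OF fin supp_lincomb] cost_eq_sum[OF fin Un_upper1]
      cost_eq_sum[OF fin Un_upper2] sum_distrib_left sum.distrib[symmetric]
  proof (rule sum_mono)
    show "\<bar>u * \<phi> a + v * \<psi> a\<bar> \<le> u * \<bar>\<phi> a\<bar> + v * \<bar>\<psi> a\<bar>" for a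
      using abs_triangle_ineq[of "u * \<phi> a" "v * \<psi> a"] assms(3,4) by (simp add: abs_mult)
  qed
qed

section \<open>Weak duality and complementary slackness for a single pair\<close>

lemma mult_le_abs:
  fixes u y :: real
  assumes "\<bar>y\<bar> \<le> 1"
  shows "u * y \<le> \<bar>u\<bar>"
  using mult_left_mono[OF assms, of "\<bar>u\<bar>"] by (simp add: abs_mult[symmetric])

lemma pairing_le_cost:
  assumes "\<forall>x. \<bar>g x\<bar> \<le> 1"
  shows "pairing \<phi> g \<le> cost \<phi>"
  unfolding pairing_def cost_def using assms by (intro sum_mono mult_le_abs) auto

text \<open>The gap is a finite sum of nonnegative terms
  \<open>\<bar>\<phi> a\<bar> - \<phi> a * g a\<close>, so it vanishes exactly when each term
  does.\<close>

lemma pairing_eq_cost_iff: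
  assumes "shift_rule \<phi>" "\<forall>x. \<bar>g x\<bar> \<le> 1"
  shows "pairing \<phi> g = cost \<phi> \<longleftrightarrow> (\<forall>a. (\<phi> a < 0 \<longrightarrow> g a = -1) \<and> (\<phi> a > 0 \<longrightarrow> g a = 1))"
proof -
  have "pairing \<phi> g = cost \<phi> \<longleftrightarrow> (\<Sum>a\<in>supp \<phi>. \<bar>\<phi> a\<bar> - \<phi> a * g a) = 0"
    by (auto simp: pairing_def cost_def sum_subtractf)
  also have "\<dots> \<longleftrightarrow> (\<forall>a\<in>supp \<phi>. \<bar>\<phi> a\<bar> - \<phi> a * g a = 0)"
    using assms by (intro sum_nonneg_eq_0_iff) (auto simp: shift_rule_def intro: mult_le_abs)
  also have "\<dots> \<longleftrightarrow> (\<forall>a. (\<phi> a < 0 \<longrightarrow> g a = -1) \<and> (\<phi> a > 0 \<longrightarrow> g a = 1))"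
  proof -
    have "(\<phi> a \<noteq> 0 \<longrightarrow> \<bar>\<phi> a\<bar> - \<phi> a * g a = 0) \<longleftrightarrow>
        (\<phi> a < 0 \<longrightarrow> g a = -1) \<and> (\<phi> a > 0 \<longrightarrow> g a = 1)" for a
    proof -
      have neg: "- \<phi> a - \<phi> a * g a = - \<phi> a * (1 + g a)" and pos: "\<phi> a - \<phi> a * g a = \<phi> a * (1 - g a)"
        by (simp_all add: algebra_simps)
      show ?thesis
        by (cases "\<phi> a" "0 :: real" rule: linorder_cases) (auto simp: neg pos)
    qed
    then show ?thesis by (auto simp: supp_def)
  qed
  finally show ?thesis .
qed

text \<open>Makes the dual objective the same pairing for every feasible rule: reflecting
  \<open>g\<close> turns the convolution at 0 into the pairing and produces the sign of the
  derivative.\<close>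

lemma feasible_pairing:
  assumes "finite \<Xi>" "symmetric_set \<Xi>" "feasible \<Xi> \<alpha> \<phi>" "g \<in> trig_space \<Xi>"
  shows "pairing \<phi> g = neg_multi_deriv \<alpha> g 0"
proof -
  have "(\<lambda>x. g (- x)) \<in> trig_space \<Xi>"
    using trig_space_reflect[OF assms(1,2,4), of 0] by simp
  then have "shift_apply \<phi> (\<lambda>x. g (- x)) 0 = multi_deriv \<alpha> (\<lambda>x. g (- x)) 0"
    using assms(3) by (simp add: feasible_def)
  then show ?thesis
    by (simp add: shift_apply_eq_pairing multi_deriv_reflect[OF assms(1,2,4)])
qed

text \<open>Describes the perturbations used to exploit optimality. Annihilation carries over to all
  points \<open>x\<close> by reflection invariance. The factors 1 fit the linear combination
  lemmas.\<close>

lemma feasible_add: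
  assumes "finite \<Xi>" "symmetric_set \<Xi>" "feasible \<Xi> \<alpha> \<phi>" "shift_rule \<eta>"
    and "\<And>g. g \<in> trig_space \<Xi> \<Longrightarrow> pairing \<eta> g = 0"
  shows "feasible \<Xi> \<alpha> (\<lambda>a. 1 * \<phi> a + 1 * \<eta> a)"
  unfolding feasible_def
proof (intro conjI ballI ext)
  have \<phi>: "shift_rule \<phi>" using assms(3) by (simp add: feasible_def)
  show "shift_rule (\<lambda>a. 1 * \<phi> a + 1 * \<eta> a)" by (rule shift_rule_lincomb[OF \<phi> assms(4)])
  fix g x assume g: "g \<in> trig_space \<Xi>"
  show "shift_apply (\<lambda>a. 1 * \<phi> a + 1 * \<eta> a) g x = multi_deriv \<alpha> g x"
    using assms(3) g
    unfolding shift_apply_eq_pairing pairing_lincomb[OF \<phi> assms(4)]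
      assms(5)[OF trig_space_reflect[OF assms(1,2) g]]
    by (simp add: feasible_def fun_eq_iff shift_apply_eq_pairing)
qed

subsection \<open>Strong duality\<close>

text \<open>Pairing each frequency with a Boolean gives one finite index set for the multipliers.
  The redundancy between \<open>\<xi>\<close> and \<open>- \<xi>\<close> is harmless.\<close>

definition trig_gen :: "(real ^ 'n) \<times> bool \<Rightarrow> real ^ 'n \<Rightarrow> real" where
  "trig_gen k x = (if snd k then cos (2 * pi * (fst k \<bullet> x)) else sin (2 * pi * (fst k \<bullet> x)))"

lemma sum_trig_gen:
  "(\<Sum>k\<in>\<Xi> \<times> UNIV. t k * trig_gen k x) =
    (\<Sum>\<xi>\<in>\<Xi>. t (\<xi>, True) * cos (2 * pi * (\<xi> \<bullet> x)) + t (\<xi>, False) * sin (2 * pi * (\<xi> \<bullet> x)))"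
proof -
  have "(\<Sum>k\<in>\<Xi> \<times> UNIV. t k * trig_gen k x) = (\<Sum>\<xi>\<in>\<Xi>. \<Sum>c\<in>UNIV. t (\<xi>, c) * trig_gen (\<xi>, c) x)"
    by (simp add: sum.cartesian_product case_prod_unfold)
  then show ?thesis by (simp add: UNIV_bool trig_gen_def add.commute)
qed

lemma trig_space_eq_trig_gen:
  assumes "finite \<Xi>" "symmetric_set \<Xi>"
  shows "trig_space \<Xi> = range (\<lambda>t x. \<Sum>k\<in>\<Xi> \<times> UNIV. t k * trig_gen k x)"
proof (intro subset_antisym subsetI)
  fix f assume "f \<in> trig_space \<Xi>"
  then obtain p q where
    "\<And>x. f x = (\<Sum>\<xi>\<in>\<Xi>. p \<xi> * cos (2 * pi * (\<xi> \<bullet> x)) + q \<xi> * sin (2 * pi * (\<xi> \<bullet> x)))"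
    using trig_spaceE by blast
  then have "f = (\<lambda>x. \<Sum>k\<in>\<Xi> \<times> UNIV. (\<lambda>(\<xi>, c). if c then p \<xi> else q \<xi>) k * trig_gen k x)"
    unfolding sum_trig_gen by auto
  then show "f \<in> range (\<lambda>t x. \<Sum>k\<in>\<Xi> \<times> UNIV. t k * trig_gen k x)" by blast
next
  fix f :: "real ^ 'a \<Rightarrow> real" assume "f \<in> range (\<lambda>t x. \<Sum>k\<in>\<Xi> \<times> UNIV. t k * trig_gen k x)"
  then obtain t where "f = (\<lambda>x. \<Sum>k\<in>\<Xi> \<times> UNIV. t k * trig_gen k x)" by blast
  then show "f \<in> trig_space \<Xi>"
    by (intro trig_spaceI[OF assms, where p = "\<lambda>\<xi>. t (\<xi>, True)" and q = "\<lambda>\<xi>. t (\<xi>, False)"])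
      (simp add: sum_trig_gen)
qed

lemma pairing_sum:
  "pairing \<phi> (\<lambda>x. \<Sum>k\<in>K. t k * g k x) = (\<Sum>k\<in>K. t k * pairing \<phi> (g k))"
  unfolding pairing_def sum_distrib_left by (subst sum.swap) (simp add: mult_ac)

text \<open>The multipliers form a function \<open>g\<close> with
  \<open>pairing \<eta> g \<le> q \<eta>\<close> for every shift rule \<open>\<eta>\<close>, where
  \<open>q\<close> is the cost increase. Suitable choices of \<open>\<eta>\<close> give the required
  properties of \<open>g\<close>.\<close>

lemma ex_dual_certificate:
  assumes "finite \<Xi>" "symmetric_set \<Xi>" and opt: "is_arg_min cost (feasible \<Xi> \<alpha>) \<phi>"
  shows "\<exists>g. dual_feasible \<Xi> g \<and> pairing \<phi> g = cost \<phi>"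
proof -
  have feas: "feasible \<Xi> \<alpha> \<phi>" and le: "\<And>\<psi>. feasible \<Xi> \<alpha> \<psi> \<Longrightarrow> cost \<phi> \<le> cost \<psi>"
    using opt unfolding is_arg_min_def by (auto simp: not_less)
  have \<phi>: "shift_rule \<phi>" using feas by (simp add: feasible_def)
  define q where "q \<eta> = cost (\<lambda>a. 1 * \<phi> a + 1 * \<eta> a) - cost \<phi>" for \<eta>
  have "\<exists>t. \<forall>\<eta>\<in>Collect shift_rule. (\<Sum>k\<in>\<Xi> \<times> UNIV. t k * pairing \<eta> (trig_gen k)) \<le> q \<eta>"
  proof (rule lagrange_multipliers)
    show "finite (\<Xi> \<times> (UNIV :: bool set))" using assms(1) by simp
    show "q (\<lambda>a. u * x a + v * y a) \<le> u * q x + v * q y"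
      if "x \<in> Collect shift_rule" "y \<in> Collect shift_rule" "0 \<le> u" "0 \<le> v" "u + v = 1" for x y u v
    proof -
      have v: "v = 1 - u" using that by simp
      \<comment> \<open>As the weights sum to 1, \<open>\<phi>\<close> can be distributed over both
        terms.\<close>
      have "(\<lambda>a. 1 * \<phi> a + 1 * (u * x a + v * y a)) =
          (\<lambda>a. u * (1 * \<phi> a + 1 * x a) + v * (1 * \<phi> a + 1 * y a))"
        by (simp add: v algebra_simps)
      then have "cost (\<lambda>a. 1 * \<phi> a + 1 * (u * x a + v * y a))
          \<le> u * cost (\<lambda>a. 1 * \<phi> a + 1 * x a) + v * cost (\<lambda>a. 1 * \<phi> a + 1 * y a)"
        using that cost_lincomb_le[OF shift_rule_lincomb[OF \<phi>] shift_rule_lincomb[OF \<phi>], of x y u v 1 1 1 1]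
        by simp
      then show ?thesis by (simp add: q_def v algebra_simps)
    qed
    \<comment> \<open>Vanishing on the generators means vanishing on the whole space, so the
      perturbed rule is feasible and cannot be cheaper than \<open>\<phi>\<close>.\<close>
    show "0 \<le> q \<eta>" if "\<eta> \<in> Collect shift_rule" "\<forall>k\<in>\<Xi> \<times> UNIV. pairing \<eta> (trig_gen k) = 0" for \<eta>
    proof -
      have "pairing \<eta> g = 0" if "g \<in> trig_space \<Xi>" for g
        using that \<open>\<forall>k\<in>\<Xi> \<times> UNIV. pairing \<eta> (trig_gen k) = 0\<close>
        unfolding trig_space_eq_trig_gen[OF assms(1,2)] by (auto simp: pairing_sum intro!: sum.neutral)
      then show ?thesis
        using le[OF feasible_add[OF assms(1,2) feas]] that(1) by (simp add: q_def)
    qed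
  qed (auto simp: shift_rule_lincomb pairing_lincomb)
  then obtain t where t: "\<And>\<eta>. shift_rule \<eta> \<Longrightarrow>
      (\<Sum>k\<in>\<Xi> \<times> UNIV. t k * pairing \<eta> (trig_gen k)) \<le> q \<eta>" by auto
  define g where "g x = (\<Sum>k\<in>\<Xi> \<times> UNIV. t k * trig_gen k x)" for x
  have g_mem: "g \<in> trig_space \<Xi>"
    unfolding trig_space_eq_trig_gen[OF assms(1,2)] g_def by blast
  have sub: "pairing \<eta> g \<le> cost (\<lambda>a. 1 * \<phi> a + 1 * \<eta> a) - cost \<phi>" if "shift_rule \<eta>" for \<eta>
    using t[OF that] by (simp add: g_def[abs_def] pairing_sum q_def)
  \<comment> \<open>Test with \<open>- \<phi>\<close>: the perturbed rule is zero and has cost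
    0.\<close>
  have "- pairing \<phi> g \<le> - cost \<phi>"
    using sub[OF shift_rule_lincomb[OF \<phi> \<phi>, of "-1" 0]] pairing_lincomb[OF \<phi> \<phi>, of "-1" 0 g]
    by (simp add: cost_def)
  \<comment> \<open>The triangle inequality cancels \<open>cost \<phi>\<close>; taking
    \<open>\<eta>\<close> to be \<open>\<phi>\<close> then gives the reverse inequality.\<close>
  moreover have bound: "pairing \<eta> g \<le> cost \<eta>" if "shift_rule \<eta>" for \<eta>
    using sub[OF that] cost_lincomb_le[OF \<phi> that, of 1 1] by simp
  ultimately have "pairing \<phi> g = cost \<phi>" using \<phi> by force
  moreover have "\<bar>g x\<bar> \<le> 1" for x
  proof -
    \<comment> \<open>Point masses of weight 1 and -1 at \<open>x\<close> turn the cost bound into a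
      pointwise bound on \<open>g\<close>.\<close>
    have supp: "supp (\<lambda>a. if a = x then s else 0) \<subseteq> {x}" for s :: real
      by (auto simp: supp_def)
    have "s * g x \<le> \<bar>s\<bar>" for s
      using bound[of "\<lambda>a. if a = x then s else 0"] finite_subset[OF supp]
        pairing_eq_sum[OF _ supp] cost_eq_sum[OF _ supp] by (simp add: shift_rule_def)
    from this[of 1] this[of "-1"] show ?thesis by simp
  qed
  ultimately show ?thesis using g_mem by (auto simp: dual_feasible_iff)
qed

section \<open>Optimality of the pair as absence of a duality gap\<close>

theorem theorem8:
  fixes \<Xi> :: "(real ^ 'n) set" and \<alpha> :: "nat ^ 'n"
    and \<phi> f :: "real ^ 'n \<Rightarrow> real"
  assumes "finite \<Xi>" and "symmetric_set \<Xi>"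
    and "\<forall>j. 1 \<le> \<alpha> $ j"
    and "feasible \<Xi> \<alpha> \<phi>"
    and "dual_feasible \<Xi> f"
  shows "is_arg_min cost (feasible \<Xi> \<alpha>) \<phi> \<and>
         is_arg_max (\<lambda>g. neg_multi_deriv \<alpha> g 0) (dual_feasible \<Xi>) f
     \<longleftrightarrow>
         supp \<phi> \<subseteq> {a. \<bar>f a\<bar> = 1} \<and>
         (\<forall>a. (\<phi> a < 0 \<longrightarrow> f a = - 1) \<and> (\<phi> a > 0 \<longrightarrow> f a = 1))"
    (is "?min \<and> ?max \<longleftrightarrow> ?supp \<and> ?signs")
proof -
  have \<phi>: "shift_rule \<phi>" using assms(4) by (simp add: feasible_def)
  have bound: "\<forall>x. \<bar>g x\<bar> \<le> 1" and mem: "g \<in> trig_space \<Xi>" if "dual_feasible \<Xi> g" for g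
    using that by (simp_all add: dual_feasible_iff)
  have value_eq: "neg_multi_deriv \<alpha> g 0 = pairing \<psi> g" if "feasible \<Xi> \<alpha> \<psi>" "dual_feasible \<Xi> g" for \<psi> g
    using feasible_pairing[OF assms(1,2) that(1) mem[OF that(2)]] by simp
  have "?min \<and> ?max \<longleftrightarrow> pairing \<phi> f = cost \<phi>"
  proof
    assume opt: "?min \<and> ?max"
    then obtain g where g: "dual_feasible \<Xi> g" "pairing \<phi> g = cost \<phi>"
      using ex_dual_certificate[OF assms(1,2)] by blast
    \<comment> \<open>The certificate attains \<open>cost \<phi>\<close>, and the optimal
      \<open>f\<close> does at least as well; weak duality forces equality.\<close>
    then have "pairing \<phi> g \<le> pairing \<phi> f"
      using opt value_eq[OF assms(4)] assms(5) unfolding is_arg_max_def by (auto simp: not_less)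
    then show "pairing \<phi> f = cost \<phi>"
      using g pairing_le_cost[OF bound[OF assms(5)], of \<phi>] by simp
  next
    assume eq: "pairing \<phi> f = cost \<phi>"
    \<comment> \<open>Both rules give \<open>f\<close> the same dual value, so \<open>cost \<phi> =
      pairing \<phi> f = pairing \<psi> f \<le> cost \<psi>\<close>.\<close>
    have "cost \<phi> \<le> cost \<psi>" if "feasible \<Xi> \<alpha> \<psi>" for \<psi>
      using value_eq[OF that assms(5)] value_eq[OF assms(4,5)] eq
        pairing_le_cost[OF bound[OF assms(5)], of \<psi>] by simp
    moreover have "neg_multi_deriv \<alpha> g 0 \<le> neg_multi_deriv \<alpha> f 0" if "dual_feasible \<Xi> g" for g
      using value_eq[OF assms(4) that] value_eq[OF assms(4,5)] eq
        pairing_le_cost[OF bound[OF that], of \<phi>] by simp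
    ultimately show "?min \<and> ?max"
      using assms(4,5) unfolding is_arg_min_def is_arg_max_def by (auto simp: not_less)
  qed
  also have "\<dots> \<longleftrightarrow> ?signs" by (rule pairing_eq_cost_iff[OF \<phi> bound[OF assms(5)]])
  also have "\<dots> \<longleftrightarrow> ?supp \<and> ?signs"
  proof -
    have "?supp" if signs: ?signs
    proof
      fix a assume "a \<in> supp \<phi>"
      then have "\<phi> a < 0 \<or> \<phi> a > 0" by (auto simp: supp_def)
      then show "a \<in> {a. \<bar>f a\<bar> = 1}" using signs by auto
    qed
    then show ?thesis by blast
  qed
  finally show ?thesis .
qed

end
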